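(* Let $g\in H(\mathbb{D})$ and let $X$ be either $\mathcal{B}$ or $\mathcal{B}_0$. If the integral operator $S_g$ is bounded on $X$, then its operator norm on $X$ is $$\|S_g\|=\sup_{z\in\mathbb{D}}|g(z)|.$$
   Context: $\mathbb{D}$ is the open unit disc in $\mathbb{C}$ and $H(\mathbb{D})$ is the space of analytic functions on $\mathbb{D}$. For $g\in H(\mathbb{D})$, the operator $S_g$ is defined on $H(\mathbb{D})$ by $S_gf(z)=\int_0^z f'(w)g(w)\,dw$. The Bloch space $\mathcal{B}$ is the Banach space of all $f\in H(\mathbb{D})$ with $\|f\|_{\mathcal{B}}=|f(0)|+\sup_{z\in\mathbb{D}}(1-|z|^2)|f'(z)|<\infty$. The little Bloch space $\mathcal{B}_0$ is the closed subspace of all $f\in\mathcal{B}$ with $\lim_{|z|\to1}(1-|z|^2)|f'(z)|=0$, with the norm $\|\cdot\|_{\mathcal{B}}$. *)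

theory Defs
  imports "HOL-Complex_Analysis.Complex_Analysis"
begin

text \<open>
  A function on the unit disc is represented by a total function on the complex plane of which
  only the values on the disc matter: the membership conditions, the norm and the
  derivative below depend on nothing else.
\<close>

definition bloch :: "(complex \<Rightarrow> complex) set" where
  "bloch = {f. f holomorphic_on ball 0 1 \<and>
               bdd_above ((\<lambda>z. (1 - (cmod z)\<^sup>2) * cmod (deriv f z)) ` ball 0 1)}"

definition bloch_norm :: "(complex \<Rightarrow> complex) \<Rightarrow> real" where
  "bloch_norm f = cmod (f 0) + (SUP z\<in>ball 0 1. (1 - (cmod z)\<^sup>2) * cmod (deriv f z))"

text \<open>The filter \<open>filtercomap norm (at_left 1)\<close> expresses that the modulus tends to 1 from
  inside the disc, uniformly in the argument.\<close>

definition little_bloch :: "(complex \<Rightarrow> complex) set" where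
  "little_bloch = {f \<in> bloch.
     ((\<lambda>z. (1 - (cmod z)\<^sup>2) * cmod (deriv f z)) \<longlongrightarrow> 0) (filtercomap norm (at_left 1))}"

definition S_op :: "(complex \<Rightarrow> complex) \<Rightarrow> (complex \<Rightarrow> complex) \<Rightarrow> complex \<Rightarrow> complex" where
  "S_op g f z = contour_integral (linepath 0 z) (\<lambda>w. deriv f w * g w)"

definition bounded_op_on ::
    "(complex \<Rightarrow> complex) set \<Rightarrow> ((complex \<Rightarrow> complex) \<Rightarrow> (complex \<Rightarrow> complex)) \<Rightarrow> bool" where
  "bounded_op_on X T \<longleftrightarrow>
     (\<forall>f\<in>X. T f \<in> X) \<and> (\<exists>C. \<forall>f\<in>X. bloch_norm (T f) \<le> C * bloch_norm f)"

text \<open>The supremum is taken in the reals, so this is meaningful only for an operator that is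
  bounded on \<open>X\<close>.\<close>

definition op_norm_on ::
    "(complex \<Rightarrow> complex) set \<Rightarrow> ((complex \<Rightarrow> complex) \<Rightarrow> (complex \<Rightarrow> complex)) \<Rightarrow> real" where
  "op_norm_on X T = (SUP f\<in>{f \<in> X. bloch_norm f \<le> 1}. bloch_norm (T f))"

end

theory Submission imports Defs begin

text \<open>
  Since \<open>S_op g f\<close> is a primitive of \<open>f' g\<close> vanishing at 0, its Bloch norm is the supremum of
  \<open>(1 - |z|\<^sup>2) |f'(z)| |g(z)|\<close>, which is at most \<open>sup |g|\<close> times the Bloch norm of \<open>f\<close>. For the
  converse, the pointwise bound of \<open>g\<close> at \<open>a\<close> is read off from one test function, a Moebius
  automorphism \<open>(z - a) / (1 - cnj a z)\<close> of the disc translated so as to vanish at 0, that is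
  \<open>f z = (1 - |a|\<^sup>2) z / (1 - cnj a z)\<close>:
  the Schwarz-Pick inequality gives \<open>(1 - |z|\<^sup>2) |f'(z)| \<le> 1\<close> on the disc, with equality at
  \<open>z = a\<close>. This \<open>f\<close> is a unit vector of the little Bloch space, because \<open>f'\<close> is bounded, so
  \<open>|g(a)| = (1 - |a|\<^sup>2) |f'(a)| |g(a)|\<close> is at most the norm of \<open>S_op g f\<close>, hence at most the
  operator norm, on either space.
\<close>

lemma S_op_has_field_derivative:
  assumes "g holomorphic_on ball 0 1" "f holomorphic_on ball 0 1" "z \<in> ball 0 1"
  shows "(S_op g f has_field_derivative deriv f z * g z) (at z)"
proof -
  have "(\<lambda>w. deriv f w * g w) holomorphic_on ball 0 1"
    using assms by (intro holomorphic_intros) auto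
  then obtain F where F:
    "\<And>w. w \<in> ball 0 1 \<Longrightarrow> (F has_field_derivative deriv f w * g w) (at w within ball 0 1)"
    using holomorphic_convex_primitive'[of "ball 0 1" "\<lambda>w. deriv f w * g w"] by auto
  have S_eq: "S_op g f w = F w - F 0" if "w \<in> ball 0 1" for w
  proof -
    have "path_image (linepath 0 w) \<subseteq> ball 0 1"
      using that by (simp add: closed_segment_subset)
    then have "((\<lambda>w. deriv f w * g w) has_contour_integral F w - F 0) (linepath 0 w)"
      using contour_integral_primitive[of "ball 0 1" F _ "linepath 0 w"] F by simp
    then show ?thesis
      unfolding S_op_def by (rule contour_integral_unique)
  qed
  have "((\<lambda>w. F w - F 0) has_field_derivative deriv f z * g z) (at z)"
    using F[OF assms(3)] assms(3) at_within_open[OF assms(3)]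
    by (auto intro!: derivative_eq_intros)
  then show ?thesis
    using has_field_derivative_transform_within_open[of _ _ z "ball 0 1" "S_op g f"]
      S_eq assms(3) by auto
qed

lemma bloch_norm_S_op:
  assumes "g holomorphic_on ball 0 1" "f holomorphic_on ball 0 1"
  shows "bloch_norm (S_op g f)
           = (SUP z\<in>ball 0 1. (1 - (cmod z)\<^sup>2) * cmod (deriv f z) * cmod (g z))"
proof -
  have "(SUP z\<in>ball 0 1. (1 - (cmod z)\<^sup>2) * cmod (deriv (S_op g f) z))
          = (SUP z\<in>ball 0 1. (1 - (cmod z)\<^sup>2) * cmod (deriv f z) * cmod (g z))"
    using DERIV_imp_deriv[OF S_op_has_field_derivative[OF assms]]
    by (intro SUP_cong) (simp_all add: norm_mult)
  moreover have "S_op g f 0 = 0"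
    by (simp add: S_op_def)
  ultimately show ?thesis
    by (simp add: bloch_norm_def)
qed

lemma bloch_seminorm_le_bloch_norm:
  assumes "f \<in> bloch" "z \<in> ball 0 1"
  shows "(1 - (cmod z)\<^sup>2) * cmod (deriv f z) \<le> bloch_norm f"
proof -
  have "(1 - (cmod z)\<^sup>2) * cmod (deriv f z)
          \<le> (SUP z\<in>ball 0 1. (1 - (cmod z)\<^sup>2) * cmod (deriv f z))"
    using assms by (intro cSUP_upper) (auto simp: bloch_def)
  then show ?thesis
    by (simp add: bloch_norm_def add_increasing)
qed

lemma bloch_norm_nonneg: "f \<in> bloch \<Longrightarrow> 0 \<le> bloch_norm f"
  using order_trans[OF _ bloch_seminorm_le_bloch_norm[of f 0]] by simp

text \<open>If \<open>f'\<close> is bounded, the weight \<open>1 - |z|\<^sup>2\<close> alone forces the decay at the boundary.\<close>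

lemma holomorphic_in_little_blochI:
  assumes hol: "f holomorphic_on ball 0 1"
    and bd: "\<And>z. z \<in> ball 0 1 \<Longrightarrow> cmod (deriv f z) \<le> B"
  shows "f \<in> little_bloch"
proof -
  have weight: "0 \<le> 1 - (cmod z)\<^sup>2" if "z \<in> ball 0 1" for z
    using that by (simp add: abs_square_le_1)
  have le: "(1 - (cmod z)\<^sup>2) * cmod (deriv f z) \<le> (1 - (cmod z)\<^sup>2) * B" if "z \<in> ball 0 1" for z
    using weight[OF that] bd[OF that] by (rule mult_left_mono[rotated])
  have "0 \<le> B"
    using bd[of 0] by (smt (verit) centre_in_ball norm_ge_zero)
  then have "(1 - (cmod z)\<^sup>2) * B \<le> B" for z
    by (simp add: mult_left_le_one_le algebra_simps)
  then have "(1 - (cmod z)\<^sup>2) * cmod (deriv f z) \<le> B" if "z \<in> ball 0 1" for z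
    using le[OF that] by (rule order_trans[rotated])
  then have "bdd_above ((\<lambda>z. (1 - (cmod z)\<^sup>2) * cmod (deriv f z)) ` ball 0 1)"
    by (rule bdd_aboveI2)
  then have "f \<in> bloch"
    using hol by (simp add: bloch_def)
  moreover have "((\<lambda>z. (1 - (cmod z)\<^sup>2) * cmod (deriv f z)) \<longlongrightarrow> 0) (filtercomap norm (at_left 1))"
  proof (rule tendsto_sandwich)
    have "eventually (\<lambda>r::real. r < 1) (at_left 1)"
      by (simp add: eventually_at_filter)
    then have ev: "eventually (\<lambda>z::complex. z \<in> ball 0 1) (filtercomap norm (at_left 1))"
      by (auto simp: eventually_filtercomap)
    show "eventually (\<lambda>z. 0 \<le> (1 - (cmod z)\<^sup>2) * cmod (deriv f z)) (filtercomap norm (at_left 1))"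
      using ev by eventually_elim (use weight in simp)
    show "eventually (\<lambda>z. (1 - (cmod z)\<^sup>2) * cmod (deriv f z) \<le> (1 - (cmod z)\<^sup>2) * B)
        (filtercomap norm (at_left 1))"
      using ev by eventually_elim (rule le)
    have "((\<lambda>r::real. (1 - r\<^sup>2) * B) \<longlongrightarrow> (1 - 1\<^sup>2) * B) (at_left 1)"
      by (intro tendsto_intros)
    then show "((\<lambda>z::complex. (1 - (cmod z)\<^sup>2) * B) \<longlongrightarrow> 0) (filtercomap norm (at_left 1))"
      using filterlim_compose[OF _ filterlim_filtercomap] by fastforce
  qed simp
  ultimately show ?thesis
    by (simp add: little_bloch_def)
qed

text \<open>The Schwarz-Pick inequality for the automorphism \<open>(z - a) / (1 - cnj a z)\<close>, whose
  derivative is \<open>(1 - |a|\<^sup>2) / (1 - cnj a z)\<^sup>2\<close>, with denominators cleared.\<close>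

lemma moebius_weight_le:
  assumes "cmod a < 1" "cmod z < 1"
  shows "(1 - (cmod z)\<^sup>2) * (1 - (cmod a)\<^sup>2) \<le> (cmod (1 - cnj a * z))\<^sup>2"
proof -
  have "(1 - (cmod z)\<^sup>2) * (1 - (cmod a)\<^sup>2) = (1 - cmod a * cmod z)\<^sup>2 - (cmod a - cmod z)\<^sup>2"
    by (simp add: power2_eq_square algebra_simps)
  also have "\<dots> \<le> (1 - cmod a * cmod z)\<^sup>2"
    by simp
  also have "\<dots> \<le> (cmod (1 - cnj a * z))\<^sup>2"
  proof (rule power_mono)
    show "1 - cmod a * cmod z \<le> cmod (1 - cnj a * z)"
      using norm_triangle_ineq2[of 1 "cnj a * z"] by (simp add: norm_mult)
    show "0 \<le> 1 - cmod a * cmod z"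
      using assms by (simp add: mult_le_one)
  qed
  finally show ?thesis .
qed

lemma exists_little_bloch_peak:
  assumes a: "a \<in> ball 0 1"
  obtains f where "f \<in> little_bloch" "bloch_norm f \<le> 1"
    "(1 - (cmod a)\<^sup>2) * cmod (deriv f a) = 1"
proof
  define f where "f = (\<lambda>z. of_real (1 - (cmod a)\<^sup>2) * z / (1 - cnj a * z))"
  have a1: "cmod a < 1"
    using a by simp
  then have a_pos: "0 < 1 - (cmod a)\<^sup>2"
    by (simp add: abs_square_less_1)
  have lower: "1 - cmod a \<le> cmod (1 - cnj a * z)" if "cmod z < 1" for z
  proof -
    have "cmod (cnj a * z) \<le> cmod a"
      using that by (simp add: norm_mult mult_left_le)
    then show ?thesis
      using norm_triangle_ineq2[of 1 "cnj a * z"] by simp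
  qed
  have nz: "1 - cnj a * z \<noteq> 0" if "cmod z < 1" for z
    using lower[OF that] a1 by auto
  have D: "(f has_field_derivative of_real (1 - (cmod a)\<^sup>2) / (1 - cnj a * z)\<^sup>2) (at z)"
    if "cmod z < 1" for z
    unfolding f_def using nz[OF that]
    by (auto intro!: derivative_eq_intros simp: power2_eq_square field_simps)
  have cmod_deriv: "cmod (deriv f z) = (1 - (cmod a)\<^sup>2) / (cmod (1 - cnj a * z))\<^sup>2"
    if "cmod z < 1" for z
    using DERIV_imp_deriv[OF D[OF that]] a_pos
    by (simp add: norm_divide norm_power del: of_real_diff)
  have "f holomorphic_on ball 0 1"
    unfolding f_def using nz by (intro holomorphic_intros) auto
  moreover have "cmod (deriv f z) \<le> (1 - (cmod a)\<^sup>2) / (1 - cmod a)\<^sup>2" if "z \<in> ball 0 1" for z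
  proof -
    have "(1 - cmod a)\<^sup>2 \<le> (cmod (1 - cnj a * z))\<^sup>2"
      using lower[of z] that a1 by (intro power_mono) auto
    then show ?thesis
      using cmod_deriv[of z] that a1 a_pos by (simp add: frac_le)
  qed
  ultimately show "f \<in> little_bloch"
    by (rule holomorphic_in_little_blochI)
  have "(1 - (cmod z)\<^sup>2) * cmod (deriv f z) \<le> 1" if "z \<in> ball 0 1" for z
    using cmod_deriv[of z] moebius_weight_le[OF a1, of z] nz[of z] that by (simp add: divide_le_eq)
  then have "(SUP z\<in>ball 0 1. (1 - (cmod z)\<^sup>2) * cmod (deriv f z)) \<le> 1"
    by (intro cSUP_least) auto
  then show "bloch_norm f \<le> 1"
    by (simp add: bloch_norm_def f_def)
  have "1 - cnj a * a = of_real (1 - (cmod a)\<^sup>2)"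
    by (simp add: complex_norm_square[symmetric] mult.commute)
  then have "cmod (1 - cnj a * a) = 1 - (cmod a)\<^sup>2"
    using a_pos by (simp del: of_real_diff)
  then show "(1 - (cmod a)\<^sup>2) * cmod (deriv f a) = 1"
    using cmod_deriv[OF a1] a_pos by (simp add: power2_eq_square)
qed

theorem lemma1:
  fixes g :: "complex \<Rightarrow> complex" and X :: "(complex \<Rightarrow> complex) set"
  assumes "g holomorphic_on ball 0 1"
    and "X = bloch \<or> X = little_bloch"
    and "bounded_op_on X (S_op g)"
  shows "ereal (op_norm_on X (S_op g)) = (SUP z\<in>ball 0 1. ereal (cmod (g z)))"
proof (rule antisym)
  have X_bloch: "X \<subseteq> bloch" and little_X: "little_bloch \<subseteq> X"
    using assms(2) by (auto simp: little_bloch_def)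
  have norm_S: "bloch_norm (S_op g f)
      = (SUP z\<in>ball 0 1. (1 - (cmod z)\<^sup>2) * cmod (deriv f z) * cmod (g z))" if "f \<in> X" for f
    using that X_bloch assms(1) by (intro bloch_norm_S_op) (auto simp: bloch_def)
  obtain C where C: "\<And>f. f \<in> X \<Longrightarrow> bloch_norm (S_op g f) \<le> C * bloch_norm f"
    using assms(3) by (auto simp: bounded_op_on_def)
  have "bloch_norm (S_op g f) \<le> \<bar>C\<bar>" if "f \<in> X" "bloch_norm f \<le> 1" for f
  proof -
    have "0 \<le> bloch_norm f"
      using that X_bloch bloch_norm_nonneg by auto
    then have "C * bloch_norm f \<le> \<bar>C\<bar> * 1"
      using that by (intro mult_mono) auto
    then show ?thesis
      using C[OF that(1)] by simp
  qed
  then have bdd: "bdd_above ((\<lambda>f. bloch_norm (S_op g f)) ` {f \<in> X. bloch_norm f \<le> 1})"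
    by (intro bdd_aboveI2[where M = "\<bar>C\<bar>"]) auto
  have g_le: "cmod (g a) \<le> op_norm_on X (S_op g)" if a: "a \<in> ball 0 1" for a
  proof -
    obtain f where f: "f \<in> little_bloch" "bloch_norm f \<le> 1"
        "(1 - (cmod a)\<^sup>2) * cmod (deriv f a) = 1"
      using exists_little_bloch_peak[OF a] .
    have fX: "f \<in> X"
      using f(1) little_X by auto
    have "S_op g f \<in> bloch"
      using fX assms(3) X_bloch by (auto simp: bounded_op_on_def)
    then have "(1 - (cmod a)\<^sup>2) * cmod (deriv (S_op g f) a) \<le> bloch_norm (S_op g f)"
      using a by (rule bloch_seminorm_le_bloch_norm)
    moreover have "deriv (S_op g f) a = deriv f a * g a"
      using fX X_bloch assms(1) a
      by (intro DERIV_imp_deriv S_op_has_field_derivative) (auto simp: bloch_def)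
    ultimately have "cmod (g a) \<le> bloch_norm (S_op g f)"
      using f(3) by (simp add: norm_mult flip: mult.assoc)
    also have "\<dots> \<le> op_norm_on X (S_op g)"
      unfolding op_norm_on_def using fX f(2) bdd by (intro cSUP_upper) auto
    finally show ?thesis .
  qed
  then show "(SUP z\<in>ball 0 1. ereal (cmod (g z))) \<le> ereal (op_norm_on X (S_op g))"
    by (intro SUP_least) auto
  \<comment> \<open>By the bound just proved, \<open>g\<close> is bounded, so the supremum may be taken in the reals.\<close>
  define G where "G = (SUP z\<in>ball 0 1. cmod (g z))"
  have bdd_g: "bdd_above ((\<lambda>z. cmod (g z)) ` ball 0 1)"
    using g_le by (intro bdd_aboveI2)
  have le_G: "cmod (g z) \<le> G" if "z \<in> ball 0 1" for z
    unfolding G_def using that bdd_g by (rule cSUP_upper)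
  have "op_norm_on X (S_op g) \<le> G"
    unfolding op_norm_on_def
  proof (rule cSUP_least)
    show "{f \<in> X. bloch_norm f \<le> 1} \<noteq> {}"
      using exists_little_bloch_peak[of 0] little_X by (metis (mono_tags, lifting) centre_in_ball
          empty_iff mem_Collect_eq subsetD zero_less_one)
  next
    fix f assume f: "f \<in> {f \<in> X. bloch_norm f \<le> 1}"
    have "(1 - (cmod z)\<^sup>2) * cmod (deriv f z) * cmod (g z) \<le> 1 * G" if z: "z \<in> ball 0 1" for z
    proof (rule mult_mono)
      show "(1 - (cmod z)\<^sup>2) * cmod (deriv f z) \<le> 1"
        using bloch_seminorm_le_bloch_norm[of f z] f X_bloch z by auto
    qed (use le_G[OF z] in auto)
    then show "bloch_norm (S_op g f) \<le> G"
      using f by (subst norm_S) (auto intro!: cSUP_least)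
  qed
  then have "ereal (op_norm_on X (S_op g)) \<le> ereal G"
    by simp
  also have "ereal G = (SUP z\<in>ball 0 1. ereal (cmod (g z)))"
  proof -
    have "(SUP z\<in>ball 0 1. ereal (cmod (g z))) \<le> ereal G"
      using le_G by (intro SUP_least) auto
    moreover have "ereal (cmod (g 0)) \<le> (SUP z\<in>ball 0 1. ereal (cmod (g z)))"
      by (intro SUP_upper) auto
    ultimately have "\<bar>SUP z\<in>ball 0 1. ereal (cmod (g z))\<bar> \<noteq> \<infinity>"
      by auto
    then show ?thesis
      unfolding G_def by (rule ereal_SUP)
  qed
  finally show "ereal (op_norm_on X (S_op g)) \<le> (SUP z\<in>ball 0 1. ereal (cmod (g z)))" .
qed

end
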